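(* For every max-min 1-bounded space 3-cardinality constrained algorithm $ALG$ and every positive integer $m$, there exists a sorted item sequence $I$ such that $OPT_3(I)=m$ and $ALG(I)\ge\frac43\cdot OPT_3(I)-\frac43$.
   Context: The $k$-cardinality constrained bin packing problem: an item sequence $I=(a_1,\dots,a_n)\in(0,1]^n$ must be packed into bins of capacity $1$ with at most $k$ items per bin; $OPT_k(I)$ is the minimum number of non-empty bins, $ALG(I)$ the number used by $ALG$. A $k$-cardinality constrained algorithm always outputs packings with at most $k$ items per bin. $I$ is sorted if $a_1\ge\cdots\ge a_n$. A max-min algorithm first sorts the input in non-increasing order and then repeatedly takes either the head (largest) or the tail (smallest) item of the currently remaining sorted sequence and packs it into a bin, each decision depending only on items already packed and the current head and tail items, without seeing other remaining items. A bin is open if it contains an item and may still receive items; closed bins never receive further items. A 1-bounded space algorithm keeps at most one open bin at any time. *)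

theory Defs
  imports Complex_Main "HOL-Library.Multiset"
begin

(* A packing state of a 1-bounded space algorithm: (closed bins, the open bin).
   The open bin is the empty list when no bin is open. *)
type_synonym bp_state = "real list list \<times> real list"

(* A max-min 1-bounded space algorithm is given by its decision function:
   given the current packing state (items already packed, with their bins),
   the current head (largest) item and the current tail (smallest) item of the
   remaining sorted sequence, it returns (take_head, new_bin):
   take_head = True: pack the head item, otherwise pack the tail item;
   new_bin = True: close the current open bin (if any) and pack the item into a
   new bin, otherwise pack the item into the current open bin. *)
type_synonym maxmin_alg = "bp_state \<Rightarrow> real \<Rightarrow> real \<Rightarrow> bool \<times> bool"

function mm_run :: "maxmin_alg \<Rightarrow> bp_state \<Rightarrow> real list \<Rightarrow> bp_state" where
  "mm_run A s [] = s"
| "mm_run A (C, B) (x # xs) =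
     (let (h, nb) = A (C, B) x (last (x # xs));
          a = (if h then x else last (x # xs));
          rest = (if h then xs else butlast (x # xs));
          s' = (if nb \<and> B \<noteq> [] then (C @ [B], [a]) else (C, B @ [a]))
      in mm_run A s' rest)"
  by pat_completeness auto
termination
  by (relation "measure (\<lambda>(_, _, l). length l)") (auto simp: Let_def split: prod.splits)

definition mm_bins :: "maxmin_alg \<Rightarrow> real list \<Rightarrow> real list list" where
  "mm_bins A I = (case mm_run A ([], []) (rev (sort I)) of
                    (C, B) \<Rightarrow> filter (\<lambda>b. b \<noteq> []) (C @ [B]))"

definition mm_cost :: "maxmin_alg \<Rightarrow> real list \<Rightarrow> nat" where
  "mm_cost A I = length (mm_bins A I)"

definition valid_item_seq :: "real list \<Rightarrow> bool" where
  "valid_item_seq I \<longleftrightarrow> (\<forall>x\<in>set I. 0 < x \<and> x \<le> 1)"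

definition is_packing :: "nat \<Rightarrow> real list \<Rightarrow> real list list \<Rightarrow> bool" where
  "is_packing k I P \<longleftrightarrow> mset (concat P) = mset I \<and>
     (\<forall>b\<in>set P. b \<noteq> [] \<and> length b \<le> k \<and> sum_list b \<le> 1)"

definition OPT :: "nat \<Rightarrow> real list \<Rightarrow> nat" where
  "OPT k I = (LEAST m. \<exists>P. is_packing k I P \<and> length P = m)"

definition k_card_constrained :: "nat \<Rightarrow> maxmin_alg \<Rightarrow> bool" where
  "k_card_constrained k A \<longleftrightarrow>
     (\<forall>I. valid_item_seq I \<longrightarrow> (\<forall>b\<in>set (mm_bins A I). length b \<le> k \<and> sum_list b \<le> 1))"

end

theory Submission
  imports Defs
begin

text \<open>
  The tail items are \<open>Tl j = 1/4 - gap j\<close> and the head items \<open>Hd k = 1/2 + gap k\<close>, where \<open>gap\<close>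
  decays geometrically. A head \<open>Hd k\<close> fits with \<open>Tl k\<close> and any further tail, but not with two
  consecutive tails \<open>Tl j\<close>, \<open>Tl (j + 1)\<close> where \<open>k < j\<close>. Each time a head is taken, the adversary
  chooses the index \<open>k\<close> of the next head as the next unused index of a tail that was packed
  already, and repeats the previous index if there is none. When the algorithm sees \<open>Hd k\<close>, the
  partner \<open>Tl k\<close> is gone, so, apart from the end of the input, at most one tail shares a bin with
  each head. An optimal packing puts a second tail into the bin of every head whose index is new.
  If \<open>k\<close> is the last index, there are \<open>m\<close> heads and \<open>m + k\<close> tails; at most \<open>k + 3\<close> tails share a
  bin with a head, and the others need at least \<open>(m - 3)/3\<close> bins of their own.
\<close>

section \<open>Single steps of a run and what later steps preserve\<close>

definition place :: "bool \<Rightarrow> real \<Rightarrow> bp_state \<Rightarrow> bp_state" where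
  "place nb a s = (if nb \<and> snd s \<noteq> [] then (fst s @ [snd s], [a]) else (fst s, snd s @ [a]))"

definition bins :: "bp_state \<Rightarrow> real list list" where
  "bins s = fst s @ [snd s]"

lemma mm_run_step:
  assumes "L \<noteq> []" "A s (hd L) (last L) = (h, nb)"
  shows "mm_run A s L = mm_run A (place nb (if h then hd L else last L) s)
                                 (if h then tl L else butlast L)"
proof (cases L)
  case Nil
  with assms show ?thesis by simp
next
  case (Cons x xs)
  obtain C B where "s = (C, B)" by (cases s)
  with assms Cons show ?thesis
    by (simp add: place_def Let_def del: last.simps butlast.simps)
qed

text \<open>Forgets which end is taken, for arguments that only need the multiset of remaining
  items.\<close>

lemma mm_run_step_cases:
  assumes "L \<noteq> []"
  obtains a nb L' where "mm_run A s L = mm_run A (place nb a s) L'"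
    "mset L = add_mset a (mset L')" "length L' < length L"
proof -
  obtain h nb where d: "A s (hd L) (last L) = (h, nb)" by (cases "A s (hd L) (last L)")
  have 1: "mset L = add_mset (hd L) (mset (tl L))"
    using assms by (cases L) auto
  have 2: "mset L = add_mset (last L) (mset (butlast L))"
    using assms by (metis append_butlast_last_id mset.simps(1,2) mset_append union_mset_add_mset_right add.right_neutral)
  show thesis
    using that[of nb "if h then hd L else last L" "if h then tl L else butlast L"]
      mm_run_step[of L A s h nb] d 1 2 assms by (cases h) auto
qed

lemma mm_run_mset:
  "mset (concat (bins (mm_run A s L))) = mset (concat (bins s)) + mset L"
proof (induction L arbitrary: s rule: length_induct)
  case (1 L)
  show ?case
  proof (cases "L = []")
    case False
    then obtain a nb L' where st: "mm_run A s L = mm_run A (place nb a s) L'"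
      "mset L = add_mset a (mset L')" "length L' < length L"
      by (rule mm_run_step_cases)
    have "mset (concat (bins (place nb a s))) = add_mset a (mset (concat (bins s)))"
      by (simp add: bins_def place_def)
    moreover have "mset (concat (bins (mm_run A (place nb a s) L')))
        = mset (concat (bins (place nb a s))) + mset L'"
      using 1 st(3) by blast
    ultimately show ?thesis using st by simp
  qed simp
qed

text \<open>Lets the final packing be judged from an intermediate state: an infeasible open bin
  stays infeasible, and every later bin is built from remaining items alone.\<close>

lemma mm_run_extends:
  "\<exists>e R. bins (mm_run A (C, B) L) = C @ (B @ e) # R \<and> set e \<subseteq> set L \<and> (\<forall>b\<in>set R. set b \<subseteq> set L)"
proof (induction L arbitrary: C B rule: length_induct)
  case (1 L)
  show ?case
  proof (cases "L = []")
    case True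
    then show ?thesis by (simp add: bins_def)
  next
    case False
    then obtain a nb L' where st: "mm_run A (C, B) L = mm_run A (place nb a (C, B)) L'"
      "mset L = add_mset a (mset L')" "length L' < length L"
      by (rule mm_run_step_cases)
    have sub: "set L = insert a (set L')"
      by (metis st(2) set_mset_add_mset_insert set_mset_mset)
    show ?thesis
    proof (cases "nb \<and> B \<noteq> []")
      case True
      then have p: "place nb a (C, B) = (C @ [B], [a])" by (simp add: place_def)
      obtain e R where "bins (mm_run A (C @ [B], [a]) L') = (C @ [B]) @ ([a] @ e) # R"
        "set e \<subseteq> set L'" "\<forall>b\<in>set R. set b \<subseteq> set L'"
        using 1 st(3) by blast
      then show ?thesis
        using st(1) p sub by (intro exI[of _ "[]"] exI[of _ "([a] @ e) # R"]) auto
    next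
      case False
      then have p: "place nb a (C, B) = (C, B @ [a])" by (auto simp: place_def)
      obtain e R where "bins (mm_run A (C, B @ [a]) L') = C @ ((B @ [a]) @ e) # R"
        "set e \<subseteq> set L'" "\<forall>b\<in>set R. set b \<subseteq> set L'"
        using 1 st(3) by blast
      then show ?thesis
        using st(1) p sub by (intro exI[of _ "a # e"] exI[of _ R]) auto
    qed
  qed
qed

section \<open>Large and small items in feasible bins\<close>

definition feasible :: "real list \<Rightarrow> bool" where
  "feasible b \<longleftrightarrow> length b \<le> 3 \<and> sum_list b \<le> 1"

lemma feasible_prefix:
  assumes "feasible (b @ e)" "\<forall>x\<in>set e. 0 < x"
  shows "feasible b"
proof -
  have "0 \<le> sum_list e" using assms(2) by (intro sum_list_nonneg) (auto intro: less_imp_le)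
  with assms(1) show ?thesis by (auto simp: feasible_def)
qed

definition num_large :: "real list \<Rightarrow> nat" where
  "num_large b = length (filter (\<lambda>x. 1/2 < x) b)"

definition num_small :: "real list \<Rightarrow> nat" where
  "num_small b = length (filter (\<lambda>x. \<not> 1/2 < x) b)"

text \<open>The small items that ride along with a large one and so need no bin of their own. The
  adversary keeps their total low.\<close>

definition shared :: "real list \<Rightarrow> nat" where
  "shared b = (if num_large b = 0 then 0 else num_small b)"

lemma num_large_simps [simp]:
  "num_large [] = 0"
  "num_large (x # b) = (if 1/2 < x then Suc (num_large b) else num_large b)"
  "num_large (b @ c) = num_large b + num_large c"
  by (simp_all add: num_large_def)

lemma num_small_simps [simp]:
  "num_small [] = 0"
  "num_small (x # b) = (if 1/2 < x then num_small b else Suc (num_small b))"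
  "num_small (b @ c) = num_small b + num_small c"
  by (simp_all add: num_small_def)

lemma num_large_concat: "num_large (concat bs) = sum_list (map num_large bs)"
  by (induction bs) auto

lemma num_small_concat: "num_small (concat bs) = sum_list (map num_small bs)"
  by (induction bs) auto

lemma num_large_small_length: "num_large b + num_small b = length b"
  by (induction b) auto

lemma num_large_mset: "mset b = mset c \<Longrightarrow> num_large b = num_large c"
  unfolding num_large_def by (metis mset_filter size_mset)

lemma num_small_mset: "mset b = mset c \<Longrightarrow> num_small b = num_small c"
  unfolding num_small_def by (metis mset_filter size_mset)

lemma num_large_le_sum:
  "\<forall>x\<in>set b. 0 < x \<Longrightarrow> real (num_large b) \<le> 2 * sum_list b"
  by (induction b) (auto simp: algebra_simps)

lemma num_large_less_sum:
  "\<forall>x\<in>set b. 0 < x \<Longrightarrow> 0 < num_large b \<Longrightarrow> real (num_large b) < 2 * sum_list b"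
proof (induction b)
  case (Cons x b)
  then show ?case
    using num_large_le_sum[of b] by (cases "num_large b = 0") (auto split: if_splits)
qed simp

lemma num_large_feasible:
  assumes "\<forall>x\<in>set b. 0 < x" "sum_list b \<le> 1"
  shows "num_large b \<le> 1"
proof (rule ccontr)
  assume "\<not> ?thesis"
  then have "2 \<le> num_large b" by simp
  moreover have "real (num_large b) < 2"
    using num_large_less_sum[of b] assms calculation by simp
  ultimately show False by linarith
qed

lemma shared_feasible: "feasible b \<Longrightarrow> shared b \<le> 2"
  using num_large_small_length[of b] by (auto simp: shared_def feasible_def)

text \<open>A large item weighs 3, a small one 1. A bin holds at most one large item; without one
  its weight is at most 3, with one it is 3 plus the shared items.\<close>

lemma weight_feasible:
  assumes "\<forall>x\<in>set b. 0 < x" "feasible b"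
  shows "3 * num_large b + num_small b \<le> 3 + shared b"
  using num_large_feasible[OF assms(1)] assms(2) num_large_small_length[of b]
  by (auto simp: shared_def feasible_def)

lemma shared_one_class:
  assumes "(\<forall>x\<in>set b. 1/2 < x) \<or> (\<forall>x\<in>set b. \<not> 1/2 < x)"
  shows "shared b = 0"
  using assms by (auto simp: shared_def num_large_def num_small_def filter_empty_conv)

text \<open>Only the open bin can still become mixed, and a feasible bin has at most two shared
  items.\<close>

lemma shared_one_class_run:
  assumes "(\<forall>x\<in>set L. 1/2 < x) \<or> (\<forall>x\<in>set L. \<not> 1/2 < x)"
    and "\<forall>b\<in>set (bins (mm_run A (C, B) L)). feasible b"
  shows "sum_list (map shared (bins (mm_run A (C, B) L))) \<le> sum_list (map shared C) + 2"
proof -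
  obtain e R where r: "bins (mm_run A (C, B) L) = C @ (B @ e) # R"
    "\<forall>b\<in>set R. set b \<subseteq> set L"
    using mm_run_extends by blast
  have "\<forall>b\<in>set R. shared b = 0"
    using r(2) assms(1) by (blast intro: shared_one_class)
  then have "sum_list (map shared R) = 0" by simp
  moreover have "shared (B @ e) \<le> 2" using assms(2) r(1) by (auto intro: shared_feasible)
  ultimately show ?thesis using r(1) by (simp del: sum_list_eq_0_iff)
qed

section \<open>Item sizes and the adversary's invariant\<close>

definition gap :: "nat \<Rightarrow> real" where "gap j = (1/8) * (1/4) ^ j"
definition Hd :: "nat \<Rightarrow> real" where "Hd k = 1/2 + gap k"
definition Tl :: "nat \<Rightarrow> real" where "Tl j = 1/4 - gap j"

lemma gap_pos: "0 < gap j" by (simp add: gap_def)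
lemma gap_Suc: "gap (Suc j) = gap j / 4" by (simp add: gap_def)
lemma gap_mono: "i \<le> j \<Longrightarrow> gap j \<le> gap i"
  by (auto simp: gap_def intro: power_decreasing)
lemma gap_le: "gap j \<le> 1/8" using gap_mono[of 0 j] by (simp add: gap_def)
lemma gap_less: "k < j \<Longrightarrow> 4 * gap j \<le> gap k"
  using gap_mono[of "Suc k" j] by (simp add: gap_Suc)

lemma Hd_bounds: "1/2 < Hd k" "Hd k \<le> 5/8" "0 < Hd k"
  using gap_pos[of k] gap_le[of k] by (auto simp: Hd_def)
lemma Tl_bounds: "0 < Tl j" "1/8 \<le> Tl j" "Tl j < 1/4" "\<not> 1/2 < Tl j"
  using gap_pos[of j] gap_le[of j] by (auto simp: Tl_def)

text \<open>The ratio 1/4 gives \<open>gap k \<ge> 4 * gap j\<close>, which exceeds the joint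
  deficit \<open>5/4 * gap j\<close> of the two tails.\<close>

lemma too_big: "k < j \<Longrightarrow> \<not> feasible [Hd k, Tl j, Tl (Suc j)]"
  using gap_less[of k j] gap_pos[of j]
  by (simp add: feasible_def Hd_def Tl_def gap_Suc)

text \<open>The remaining input when \<open>j\<close> tails are packed and \<open>ks\<close> are the indices of the remaining heads.\<close>

definition inst :: "nat \<Rightarrow> nat \<Rightarrow> nat list \<Rightarrow> real list" where
  "inst j n ks = map Hd ks @ rev (map Tl [Suc j..<Suc n])"

text \<open>Steps of 0 or 1 keep the heads sorted and let every index from \<open>k\<close> to
  \<open>last ks\<close> occur, so that each of these tails has a partner head.\<close>

definition heads_from :: "nat \<Rightarrow> nat list \<Rightarrow> bool" where
  "heads_from k ks \<longleftrightarrow> ks \<noteq> [] \<and> hd ks = k \<and> successively (\<lambda>a b. b = a \<or> b = Suc a) ks"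

text \<open>The possible open bins while both heads and tails remain. An open bin with a tail
  contains the latest one, \<open>Tl j\<close>. The strict inequalities are those that
  \<open>too_big\<close> needs to keep a head from sharing with two tails.\<close>

definition shape :: "nat \<Rightarrow> nat \<Rightarrow> real list \<Rightarrow> bool" where
  "shape k j B \<longleftrightarrow> B = [] \<or> (\<exists>k'\<le>j. B = [Hd k'])
     \<or> (\<exists>k'<j. B = [Hd k', Tl j] \<or> B = [Tl j, Hd k'])
     \<or> (B = [Tl j] \<and> k < j)
     \<or> (\<exists>i. j = Suc i \<and> B = [Tl i, Tl j] \<and> k < i)
     \<or> (length B = 3 \<and> num_large B = 0)"

text \<open>
  Here \<open>k\<close> is the index of the visible head and \<open>j\<close> the number of packed tails. A large item in
  the open bin is counted as if a tail already shared its bin.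
\<close>

definition adv_inv :: "nat \<Rightarrow> nat \<Rightarrow> bp_state \<Rightarrow> bool" where
  "adv_inv k j s \<longleftrightarrow> k \<le> j \<and> shape k j (snd s)
     \<and> sum_list (map shared (fst s)) + num_large (snd s) \<le> Suc k
     \<and> sum_list (map shared (fst s)) + num_small (snd s) \<le> j"

text \<open>Makes both counts in \<open>adv_inv\<close> survive closing the open bin, when
  \<open>shared B\<close> replaces \<open>num_large B\<close> and
  \<open>num_small B\<close>.\<close>

lemma shape_shared: "shape k j B \<Longrightarrow> shared B \<le> num_large B \<and> shared B \<le> num_small B"
  using Hd_bounds Tl_bounds by (auto simp: shape_def shared_def)

text \<open>If \<open>k < j\<close>, the bound \<open>Suc k\<close> grows by one and pays for the
  new head. If \<open>k = j\<close>, the head must open a bin, and the second count, bounded by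
  \<open>j\<close>, leaves room for it.\<close>

lemma adv_inv_head:
  assumes "adv_inv k j s" "feasible (snd (place nb (Hd k) s))"
  shows "adv_inv (if k < j then Suc k else k) j (place nb (Hd k) s)"
proof -
  obtain C B where s: "s = (C, B)" by (cases s)
  note sh = shape_shared[of k j B]
  show ?thesis
  proof (cases "nb \<or> B = []")
    case True
    then show ?thesis using assms(1) s sh Hd_bounds
      by (auto simp: adv_inv_def place_def shape_def)
  next
    case False
    then have f: "feasible (B @ [Hd k])" using assms(2) s by (simp add: place_def)
    have "shape k j B" using assms(1) s by (simp add: adv_inv_def)
    with False consider
        k' where "B = [Hd k']"
      | k' i where "B = [Hd k', Tl i] \<or> B = [Tl i, Hd k']"
      | "B = [Tl j]" "k < j"
      | i where "j = Suc i" "B = [Tl i, Tl j]" "k < i"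
      | "length B = 3"
      unfolding shape_def by blast
    then show ?thesis
    proof cases
      case 1
      with f Hd_bounds(1)[of k] Hd_bounds(1)[of k'] show ?thesis by (simp add: feasible_def)
    next
      case 2
      with f Hd_bounds(1)[of k] Hd_bounds(1)[of k'] Tl_bounds(1)[of i] show ?thesis
        by (auto simp: feasible_def)
    next
      case 3
      with assms(1) s False Hd_bounds Tl_bounds show ?thesis
        by (auto simp: adv_inv_def place_def shape_def)
    next
      case 4
      with f too_big[of k i] show ?thesis by (simp add: feasible_def)
    next
      case 5
      with f show ?thesis by (simp add: feasible_def)
    qed
  qed
qed

text \<open>The second count and \<open>j\<close> can rise together. The first count does not grow:
  a tail joins a head only in \<open>[Hd k']\<close>, where it was charged in advance, and
  \<open>too_big\<close> excludes a second one.\<close>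

lemma adv_inv_tail:
  assumes "adv_inv k j s" "feasible (snd (place nb (Tl (Suc j)) s))"
  shows "adv_inv k (Suc j) (place nb (Tl (Suc j)) s)"
proof -
  obtain C B where s: "s = (C, B)" by (cases s)
  note sh = shape_shared[of k j B]
  show ?thesis
  proof (cases "nb \<or> B = []")
    case True
    then show ?thesis using assms(1) s sh Tl_bounds
      by (auto simp: adv_inv_def place_def shape_def)
  next
    case False
    then have f: "feasible (B @ [Tl (Suc j)])" using assms(2) s by (simp add: place_def)
    have "shape k j B" using assms(1) s by (simp add: adv_inv_def)
    with False consider
        k' where "B = [Hd k']" "k' \<le> j"
      | k' where "B = [Hd k', Tl j] \<or> B = [Tl j, Hd k']" "k' < j"
      | "B = [Tl j]" "k < j"
      | i where "j = Suc i" "B = [Tl i, Tl j]" "k < i"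
      | "length B = 3"
      unfolding shape_def by blast
    then show ?thesis
    proof cases
      case 1
      then have "k' < Suc j" "B @ [Tl (Suc j)] = [Hd k', Tl (Suc j)]" by auto
      then have "shape k (Suc j) (B @ [Tl (Suc j)])" unfolding shape_def by blast
      with 1 assms(1) s False Hd_bounds Tl_bounds show ?thesis
        by (simp add: adv_inv_def place_def)
    next
      case 2
      with f too_big[of k' j] show ?thesis by (auto simp: feasible_def)
    next
      case 5
      with f show ?thesis by (simp add: feasible_def)
    qed (use assms(1) s False Hd_bounds Tl_bounds in
          \<open>auto simp: adv_inv_def place_def shape_def\<close>)
  qed
qed

lemma adv_inv_closed:
  assumes "adv_inv k j s"
  shows "sum_list (map shared (fst (place nb a s))) \<le> Suc k"
  using assms shape_shared[of k j "snd s"] by (auto simp: adv_inv_def place_def)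


section \<open>The adversary's strategy\<close>

lemma inst_facts:
  assumes "ks \<noteq> []" "j < n"
  shows "inst j n ks \<noteq> []" "hd (inst j n ks) = Hd (hd ks)" "last (inst j n ks) = Tl (Suc j)"
    "tl (inst j n ks) = inst j n (tl ks)" "butlast (inst j n ks) = inst (Suc j) n ks"
proof -
  have u: "[Suc j..<Suc n] = Suc j # [Suc (Suc j)..<Suc n]"
    using assms(2) by (simp add: upt_rec)
  show "inst j n ks \<noteq> []" "hd (inst j n ks) = Hd (hd ks)" "tl (inst j n ks) = inst j n (tl ks)"
    using assms(1) by (auto simp: inst_def hd_append hd_map map_tl)
  show "last (inst j n ks) = Tl (Suc j)" "butlast (inst j n ks) = inst (Suc j) n ks"
    unfolding inst_def u by (auto simp: butlast_append)
qed

lemma inst_positive: "x \<in> set (inst j n ks) \<Longrightarrow> 0 < x"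
  using Hd_bounds Tl_bounds by (auto simp: inst_def)

lemma heads_from_upt: "heads_from k [k..<Suc (k + r)]"
proof -
  have "successively (\<lambda>a b. b = a \<or> b = Suc a) [k..<Suc (k + r)]"
    by (auto simp: successively_conv_nth nth_append)
  then show ?thesis by (simp add: heads_from_def hd_append upt_rec[of k])
qed

lemma heads_from_last: "heads_from k ks \<Longrightarrow> k \<le> last ks"
proof (induction ks arbitrary: k)
  case (Cons a ks)
  then show ?case
    by (cases ks) (auto simp: heads_from_def dest: Suc_leD)
qed (simp add: heads_from_def)

text \<open>\<open>r\<close> heads follow the visible one, and at most \<open>m + k + r\<close>
  tails occur, since the index rises by at most one per head. The list \<open>ks\<close> is built
  from the end of the game backwards, because \<open>last ks\<close> also fixes the number of
  tails.\<close>

lemma adversary: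
  assumes "0 < m" "j < m + k + r" "adv_inv k j s"
  shows "\<exists>ks. heads_from k ks \<and> length ks = Suc r \<and> j < m + last ks \<and>
    ((\<forall>b\<in>set (bins (mm_run A s (inst j (m + last ks) ks))). feasible b) \<longrightarrow>
     sum_list (map shared (bins (mm_run A s (inst j (m + last ks) ks)))) \<le> last ks + 3)"
  using assms(2,3)
proof (induction "r + (m + k + r - j)" arbitrary: r k j s rule: less_induct)
  case less
  let ?final = "\<lambda>ks. bins (mm_run A s (inst j (m + last ks) ks))"
  let ?fin = "\<lambda>s j n ks. bins (mm_run A s (inst j n ks))"
  obtain h nb where d: "A s (Hd k) (Tl (Suc j)) = (h, nb)"
    by (cases "A s (Hd k) (Tl (Suc j))")
  define a where "a = (if h then Hd k else Tl (Suc j))"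
  define s' where "s' = place nb a s"
  \<comment> \<open>All admissible \<open>ks\<close> show the same two ends, so the algorithm's
    first decision does not depend on the choice of \<open>ks\<close>.\<close>
  have run: "?final ks = (if h then ?fin s' j (m + last ks) (tl ks)
      else ?fin s' (Suc j) (m + last ks) ks)"
    if "heads_from k ks" "j < m + last ks" for ks
  proof -
    have "ks \<noteq> []" "hd ks = k" using that(1) by (auto simp: heads_from_def)
    with mm_run_step[OF inst_facts(1)[OF \<open>ks \<noteq> []\<close> that(2)], of A s h nb] d
    show ?thesis
      by (simp add: inst_facts[OF \<open>ks \<noteq> []\<close> that(2)] s'_def a_def)
  qed
  let ?up = "[k..<Suc (k + r)]"
  have up: "heads_from k ?up" "length ?up = Suc r" "last ?up = k + r"
    using heads_from_upt by auto
  have k1: "sum_list (map shared (fst s')) \<le> Suc k"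
    using adv_inv_closed[OF less.prems(2)] by (simp add: s'_def)
  have s'_eq: "s' = (fst s', snd s')" by simp
  show ?case
  proof (cases "feasible (snd s')")
    \<comment> \<open>The open bin stays infeasible, so the implication is vacuous. The list
      \<open>?up\<close> meets the bound on \<open>j\<close> because its last index is
      \<open>k + r\<close>.\<close>
    case False
    have "\<not> (\<forall>b\<in>set (?final ?up). feasible b)"
    proof
      assume f: "\<forall>b\<in>set (?final ?up). feasible b"
      obtain i ks where r: "?final ?up = ?fin s' i (m + last ?up) ks"
        using run[OF up(1)] less.prems(1) up(3) by (cases h) auto
      obtain e R where "?fin s' i (m + last ?up) ks = fst s' @ (snd s' @ e) # R"
        "set e \<subseteq> set (inst i (m + last ?up) ks)"
        using mm_run_extends[of A "fst s'" "snd s'"] s'_eq by metis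
      then show False
        using f r feasible_prefix[of "snd s'" e] inst_positive False by (metis in_set_conv_decomp subsetD)
    qed
    then show ?thesis using up less.prems(1) by (intro exI[of _ ?up]) (auto simp: add_ac)
  next
    case feas: True
    show ?thesis
    proof (cases h)
      case h: True
      have inv': "adv_inv (if k < j then Suc k else k) j s'"
        using adv_inv_head[OF less.prems(2)] feas h by (simp add: s'_def a_def)
      show ?thesis
      proof (cases r)
        \<comment> \<open>Only tails remain: at most \<open>Suc k\<close> shared items in closed
          bins and 2 in the open bin give \<open>k + 3\<close>.\<close>
        case 0
        have "sum_list (map shared (?final [k])) \<le> k + 3"
          if f: "\<forall>b\<in>set (?final [k]). feasible b"
        proof -
          have e: "?final [k] = ?fin (fst s', snd s') j (m + k) []"
            using run[of "[k]"] h less.prems(1) 0 by (simp add: heads_from_def)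
          have "\<forall>x\<in>set (inst j (m + k) []). \<not> 1/2 < x"
            using Tl_bounds by (auto simp: inst_def)
          then show ?thesis
            using shared_one_class_run[of "inst j (m + k) []" A "fst s'" "snd s'"] f k1 e by simp
        qed
        then show ?thesis
          using 0 less.prems(1) by (intro exI[of _ "[k]"]) (auto simp: heads_from_def)
      next
        case (Suc r')
        define k' where "k' = (if k < j then Suc k else k)"
        have kj: "k \<le> j" using less.prems(2) by (simp add: adv_inv_def)
        \<comment> \<open>If the index repeats, \<open>k' + r'\<close> is one less than
          \<open>k + r\<close>, but then \<open>j = k\<close> and \<open>0 < m\<close>
          suffices.\<close>
        have j': "j < m + k' + r'"
          using less.prems(1) Suc kj assms(1) by (auto simp: k'_def)
        have "r' + (m + k' + r' - j) < r + (m + k + r - j)"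
          using Suc less.prems(1) by (auto simp: k'_def)
        from less.hyps[OF this j'] inv' obtain ks where
          ks: "heads_from k' ks" "length ks = Suc r'" "j < m + last ks"
            "(\<forall>b\<in>set (?fin s' j (m + last ks) ks). feasible b) \<longrightarrow>
             sum_list (map shared (?fin s' j (m + last ks) ks)) \<le> last ks + 3"
          unfolding k'_def by blast
        have c: "heads_from k (k # ks)" "last (k # ks) = last ks"
          using ks(1) by (auto simp: heads_from_def successively_Cons k'_def split: if_splits)
        have "?final (k # ks) = ?fin s' j (m + last ks) ks"
          using run[OF c(1)] h c(2) ks(3) by simp
        then show ?thesis
          using c ks Suc by (intro exI[of _ "k # ks"]) auto
      qed
    next
      case h: False
      have inv': "adv_inv k (Suc j) s'"
        using adv_inv_tail[OF less.prems(2)] feas h by (simp add: s'_def a_def)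
      show ?thesis
      proof (cases "Suc j < m + k + r")
        case True
        have "r + (m + k + r - Suc j) < r + (m + k + r - j)" using True by simp
        from less.hyps[OF this True inv'] obtain ks where
          ks: "heads_from k ks" "length ks = Suc r" "Suc j < m + last ks"
            "(\<forall>b\<in>set (?fin s' (Suc j) (m + last ks) ks). feasible b) \<longrightarrow>
             sum_list (map shared (?fin s' (Suc j) (m + last ks) ks)) \<le> last ks + 3"
          by blast
        then show ?thesis using run[of ks] h by (intro exI[of _ ks]) auto
      next
        \<comment> \<open>This is the last tail that any continuation admits. The list
          \<open>?up\<close> attains the maximal index, so only heads remain.\<close>
        case False
        then have n: "m + (k + r) = Suc j" using less.prems(1) by simp
        have "sum_list (map shared (?final ?up)) \<le> k + r + 3"
          if f: "\<forall>b\<in>set (?final ?up). feasible b"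
        proof -
          have e: "?final ?up = ?fin (fst s', snd s') (Suc j) (Suc j) ?up"
            using run[OF up(1)] h up(3) n by simp
          have "\<forall>x\<in>set (inst (Suc j) (Suc j) ?up). 1/2 < x"
            using Hd_bounds by (auto simp: inst_def)
          then show ?thesis
            using shared_one_class_run[of "inst (Suc j) (Suc j) ?up" A "fst s'" "snd s'"] f k1 e
            by simp
        qed
        then show ?thesis
          using up n by (intro exI[of _ ?up]) auto
      qed
    qed
  qed
qed

section \<open>Optimal packings\<close>

text \<open>Each head takes one arbitrary tail. A head with a new index \<open>k\<close> also takes
  \<open>Tl k\<close>: the two sum to exactly 3/4, and every tail is below 1/4. Index 0 has no tail
  of its own, as tails are numbered from 1.\<close>

lemma packing_of_heads:
  assumes "heads_from 0 ks" "length qs = length ks"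
  shows "\<exists>P. length P = length ks \<and>
    mset (concat P) = mset (map Hd ks) + mset (map Tl [1..<Suc (last ks)]) + mset (map Tl qs) \<and>
    (\<forall>b\<in>set P. b \<noteq> [] \<and> length b \<le> 3 \<and> sum_list b \<le> 1)"
  using assms
proof (induction ks arbitrary: qs rule: rev_induct)
  case Nil
  then show ?case by (simp add: heads_from_def)
next
  case (snoc k ks)
  obtain q qs' where q: "qs = qs' @ [q]" "length qs' = length ks"
    using snoc.prems(2) by (cases qs rule: rev_cases) auto
  have two: "Hd k + Tl q \<le> 1" using Hd_bounds(2)[of k] Tl_bounds(3)[of q] by simp
  have three: "Hd k + (Tl k + Tl q) \<le> 1" using gap_pos[of q] by (simp add: Hd_def Tl_def)
  show ?case
  proof (cases "ks = []")
    case True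
    then show ?thesis using q snoc.prems two
      by (intro exI[of _ "[[Hd k, Tl q]]"]) (auto simp: heads_from_def)
  next
    case False
    then have hf: "heads_from 0 ks" and last: "k = last ks \<or> k = Suc (last ks)"
      using snoc.prems(1) by (auto simp: heads_from_def successively_append_iff)
    obtain P where P: "length P = length ks"
      "mset (concat P) = mset (map Hd ks) + mset (map Tl [1..<Suc (last ks)]) + mset (map Tl qs')"
      "\<forall>b\<in>set P. b \<noteq> [] \<and> length b \<le> 3 \<and> sum_list b \<le> 1"
      using snoc.IH[OF hf q(2)] by blast
    from last show ?thesis
    proof
      assume "k = last ks"
      then show ?thesis using P q two
        by (intro exI[of _ "P @ [[Hd k, Tl q]]"]) auto
    next
      assume "k = Suc (last ks)"
      then show ?thesis using P q three
        by (intro exI[of _ "P @ [[Hd k, Tl k, Tl q]]"]) auto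
    qed
  qed
qed

lemma num_large_le_packing:
  assumes "is_packing 3 I P" "\<forall>x\<in>set I. 0 < x"
  shows "num_large I \<le> length P"
proof -
  have m: "mset (concat P) = mset I" using assms(1) by (simp add: is_packing_def)
  then have "set (concat P) = set I" by (metis set_mset_mset)
  then have "\<forall>b\<in>set P. num_large b \<le> 1"
    using assms by (intro ballI num_large_feasible) (auto simp: is_packing_def)
  then have "sum_list (map num_large P) \<le> length P"
    by (induction P) auto
  then show ?thesis using num_large_mset[OF m] by (simp add: num_large_concat)
qed

theorem theorem9:
  fixes A :: maxmin_alg and m :: nat
  assumes "k_card_constrained 3 A"
    and "m > 0"
  shows "\<exists>I. valid_item_seq I \<and> sorted_wrt (\<ge>) I \<and> OPT 3 I = m \<and>
             real (mm_cost A I) \<ge> 4/3 * real (OPT 3 I) - 4/3"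
proof -
  have "adv_inv 0 0 ([], [])" by (simp add: adv_inv_def shape_def)
  with adversary[of m 0 0 "m - 1" "([], [])" A] assms(2) obtain ks where
    hf: "heads_from 0 ks" and len: "length ks = m" and
    few: "(\<forall>b\<in>set (bins (mm_run A ([], []) (inst 0 (m + last ks) ks))). feasible b) \<longrightarrow>
      sum_list (map shared (bins (mm_run A ([], []) (inst 0 (m + last ks) ks)))) \<le> last ks + 3"
    by auto
  define I where "I = inst 0 (m + last ks) ks"
  define F where "F = bins (mm_run A ([], []) I)"
  have pos: "\<forall>x\<in>set I. 0 < x" using inst_positive by (auto simp: I_def)
  have "x \<le> 1" if "x \<in> set I" for x
  proof -
    from that consider k where "x = Hd k" | j where "x = Tl j"
      by (auto simp: I_def inst_def)
    then show ?thesis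
    proof cases
      case 1
      with Hd_bounds(2)[of k] show ?thesis by simp
    next
      case 2
      with Tl_bounds(3)[of j] show ?thesis by simp
    qed
  qed
  with pos have valid: "valid_item_seq I" by (simp add: valid_item_seq_def)
  have "sorted_wrt (\<le>) ks"
  proof -
    have "successively (\<le>) ks"
      using hf unfolding heads_from_def by (auto elim: successively_mono)
    then show ?thesis by (simp add: successively_conv_sorted_wrt)
  qed
  then have s1: "sorted_wrt (\<ge>) (map Hd ks)"
    unfolding sorted_wrt_map
    by (rule sorted_wrt_mono_rel[rotated]) (simp add: Hd_def gap_mono)
  have s2: "sorted_wrt (\<ge>) (rev (map Tl [Suc 0..<Suc n]))" for n
    unfolding sorted_wrt_rev sorted_wrt_map
    by (rule sorted_wrt_mono_rel[OF _ sorted_upt]) (simp add: Tl_def gap_mono)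
  have sorted: "sorted_wrt (\<ge>) I"
    unfolding I_def inst_def sorted_wrt_append
  proof (intro conjI ballI s1 s2)
    fix x y assume "x \<in> set (map Hd ks)" "y \<in> set (rev (map Tl [Suc 0..<Suc (m + last ks)]))"
    then obtain k j where "x = Hd k" "y = Tl j" by auto
    then show "y \<le> x" using Hd_bounds(1)[of k] Tl_bounds(3)[of j] by simp
  qed
  have large: "num_large I = m" and small: "num_small I = m + last ks"
    using Hd_bounds(1) Tl_bounds(4) len
    by (auto simp: I_def inst_def num_large_def num_small_def filter_empty_conv)

  have opt: "OPT 3 I = m"
    unfolding OPT_def
  proof (rule Least_equality)
    \<comment> \<open>The tails up to \<open>last ks\<close> go to heads with a new index, the other
      \<open>m\<close> tails one to each head.\<close>
    obtain P where P: "length P = length ks"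
      "mset (concat P) = mset (map Hd ks) + mset (map Tl [1..<Suc (last ks)])
         + mset (map Tl [Suc (last ks)..<Suc (last ks) + m])"
      "\<forall>b\<in>set P. b \<noteq> [] \<and> length b \<le> 3 \<and> sum_list b \<le> 1"
      using packing_of_heads[OF hf, of "[Suc (last ks)..<Suc (last ks) + m]"] len
      by (auto simp del: upt_Suc)
    have "[1..<Suc (m + last ks)] = [1..<Suc (last ks)] @ [Suc (last ks)..<Suc (last ks) + m]"
      using upt_add_eq_append[of 1 "Suc (last ks)" m] by (simp add: add.commute)
    with P have "is_packing 3 I P" by (simp add: is_packing_def I_def inst_def del: upt_Suc)
    with P(1) len show "\<exists>P. is_packing 3 I P \<and> length P = m" by blast
  next
    fix n assume "\<exists>P. is_packing 3 I P \<and> length P = n"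
    with num_large_le_packing pos large show "m \<le> n" by blast
  qed

  \<comment> \<open>Hence the run on \<open>rev (sort I)\<close> is the run on \<open>I\<close>
    itself.\<close>
  have "sort I = rev I"
    using sorted by (intro properties_for_sort) (auto simp: sorted_wrt_rev)
  then have mb: "mm_bins A I = filter (\<lambda>b. b \<noteq> []) F"
    by (auto simp: mm_bins_def F_def bins_def split: prod.splits)
  have feas: "\<forall>b\<in>set F. feasible b"
  proof
    fix b assume "b \<in> set F"
    then have "b = [] \<or> b \<in> set (mm_bins A I)" using mb by auto
    then show "feasible b"
      using assms(1) valid unfolding k_card_constrained_def feasible_def by auto
  qed
  have items: "mset (concat F) = mset I"
    using mm_run_mset[of A "([], [])" I] by (simp add: F_def bins_def)
  have "\<forall>b\<in>set F. \<forall>x\<in>set b. 0 < x"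
    using pos items by (metis UN_I set_concat set_mset_mset)
  \<comment> \<open>\<open>weight_feasible\<close> summed over the bins; an empty bin adds 0 to both
    sides. Inserting the counts then makes \<open>last ks\<close> cancel.\<close>
  then have "3 * sum_list (map num_large F) + sum_list (map num_small F)
      \<le> 3 * length (filter (\<lambda>b. b \<noteq> []) F) + sum_list (map shared F)"
    using feas
  proof (induction F)
    case (Cons b F)
    then show ?case using weight_feasible[of b] by auto
  qed simp
  then have "3 * m + (m + last ks) \<le> 3 * mm_cost A I + (last ks + 3)"
    using few feas large small num_large_mset[OF items] num_small_mset[OF items] mb
    by (simp add: num_large_concat num_small_concat mm_cost_def F_def I_def)
  then have "4 * real m \<le> 3 * real (mm_cost A I) + 3" by linarith
  with valid sorted opt show ?thesis by (intro exI[of _ I]) auto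
qed

end
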